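(* Let $\mathcal{A}=\mathbb{C}[t^{\pm1}]$ and let $\sigma$ be the algebra endomorphism of $\mathcal{A}$ with $\sigma(t)=qt^s$, where $q\in\mathbb{C}^*$, $s\in\mathbb{Z}$ and $s\neq1$. Let $d=|s-1|$. Then $$\mathcal{D}_\sigma(\mathcal{A})=\mathbb{C}d_0\oplus\mathbb{C}d_1\oplus\cdots\oplus\mathbb{C}d_{d-1}\oplus\mathcal{I}nn_\sigma(\mathcal{A})$$ as a $\mathbb{C}$-vector space.
   Context: A $\sigma$-derivation of $\mathcal{A}$ is a $\mathbb{C}$-linear map $D:\mathcal{A}\to\mathcal{A}$ with $D(ab)=\sigma(a)D(b)+D(a)b$ for all $a,b\in\mathcal{A}$; $\mathcal{D}_\sigma(\mathcal{A})$ is the set of all of them, a left $\mathcal{A}$-module via $(a\Delta)(r)=a\Delta(r)$. A $\sigma$-derivation is inner if it equals $r\mapsto p(r-\sigma(r))$ for some $p\in\mathcal{A}$; $\mathcal{I}nn_\sigma(\mathcal{A})$ is the set of inner ones. Put $g=1-\lambda t^d$ with $\lambda=q$, $d=s-1$ if $s\geq1$, and $\lambda=q^{-1}$, $d=1-s$ if $s<1$; this $g$ is a greatest common divisor of $(\mathrm{id}-\sigma)(\mathcal{A})$. Let $\Delta=(\mathrm{id}-\sigma)/g$; then $\mathcal{D}_\sigma(\mathcal{A})=\mathcal{A}\Delta$ is free of rank one over $\mathcal{A}$. For $n\in\mathbb{Z}$ let $d_n=-t^n\Delta$ (so the $d_n$ form a $\mathbb{C}$-basis of $\mathcal{D}_\sigma(\mathcal{A})$).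 *)

theory Defs
  imports Complex_Main "HOL-Library.Poly_Mapping" "HOL-Library.Function_Algebras"
begin

text \<open>
  Laurent polynomials are finitely supported functions on the integers with the
  convolution product, i.e. the group algebra of the integers over the complex numbers.
  The pointwise addition of maps between them comes from \<^theory>\<open>HOL-Library.Function_Algebras\<close>.
\<close>

type_synonym laurent = "int \<Rightarrow>\<^sub>0 complex"

abbreviation tpow :: "int \<Rightarrow> laurent" where
  "tpow n \<equiv> Poly_Mapping.single n 1"

definition lscale :: "complex \<Rightarrow> laurent \<Rightarrow> laurent" where
  "lscale c a = Poly_Mapping.single 0 c * a"

definition mscale :: "complex \<Rightarrow> (laurent \<Rightarrow> laurent) \<Rightarrow> (laurent \<Rightarrow> laurent)" where
  "mscale c D = (\<lambda>r. lscale c (D r))"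

interpretation laurent: vector_space lscale
proof
  show "lscale c (lscale c' a) = lscale (c * c') a" for c c' a
    unfolding lscale_def mult.assoc[symmetric] by (simp add: mult_single)
qed (simp_all add: lscale_def distrib_left distrib_right single_add)

interpretation lmap: vector_space mscale
  by unfold_locales
    (simp_all add: mscale_def fun_eq_iff laurent.scale_right_distrib laurent.scale_left_distrib)

definition algebra_endo :: "(laurent \<Rightarrow> laurent) \<Rightarrow> bool" where
  "algebra_endo \<sigma> \<longleftrightarrow>
     Vector_Spaces.linear lscale lscale \<sigma> \<and> \<sigma> 1 = 1 \<and> (\<forall>a b. \<sigma> (a * b) = \<sigma> a * \<sigma> b)"

definition sigma_derivations :: "(laurent \<Rightarrow> laurent) \<Rightarrow> (laurent \<Rightarrow> laurent) set" where
  "sigma_derivations \<sigma> =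
     {D. Vector_Spaces.linear lscale lscale D \<and> (\<forall>a b. D (a * b) = \<sigma> a * D b + D a * b)}"

definition inner_derivations :: "(laurent \<Rightarrow> laurent) \<Rightarrow> (laurent \<Rightarrow> laurent) set" where
  "inner_derivations \<sigma> = {D \<in> sigma_derivations \<sigma>. \<exists>p. D = (\<lambda>r. p * (r - \<sigma> r))}"

definition g_poly :: "complex \<Rightarrow> int \<Rightarrow> laurent" where
  "g_poly q s =
     (if s \<ge> 1 then 1 - lscale q (tpow (s - 1)) else 1 - lscale (inverse q) (tpow (1 - s)))"

text \<open>
  The quotient \<open>(id - \<sigma>)/g\<close>; it exists and is unique by \<open>Delta_eq\<close> and \<open>Delta_unique\<close> below.
\<close>

definition Delta :: "complex \<Rightarrow> int \<Rightarrow> (laurent \<Rightarrow> laurent) \<Rightarrow> laurent \<Rightarrow> laurent" where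
  "Delta q s \<sigma> r = (THE b. g_poly q s * b = r - \<sigma> r)"

definition dmap :: "complex \<Rightarrow> int \<Rightarrow> (laurent \<Rightarrow> laurent) \<Rightarrow> int \<Rightarrow> laurent \<Rightarrow> laurent" where
  "dmap q s \<sigma> n = (\<lambda>r. - tpow n * Delta q s \<sigma> r)"

text \<open>
  \<open>V\<close> is the internal direct sum of the list \<open>Ws\<close> of subspaces: every element of \<open>V\<close> is in
  exactly one way a sum with one summand from each member of \<open>Ws\<close>.
\<close>

definition internal_direct_sum ::
    "('k::field \<Rightarrow> 'v::ab_group_add \<Rightarrow> 'v) \<Rightarrow> 'v set \<Rightarrow> 'v set list \<Rightarrow> bool" where
  "internal_direct_sum scale V Ws \<longleftrightarrow>
     module.subspace scale V \<and>
     (\<forall>W\<in>set Ws. module.subspace scale W \<and> W \<subseteq> V) \<and>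
     (\<forall>v\<in>V. \<exists>!ws. list_all2 (\<in>) ws Ws \<and> v = sum_list ws)"

lemma g_poly_nonzero:
  assumes "s \<noteq> 1"
  shows "g_poly q s \<noteq> 0"
proof
  assume "g_poly q s = 0"
  then have "Poly_Mapping.lookup (g_poly q s) 0 = 0" by simp
  with assms show False
    by (auto simp: g_poly_def lscale_def mult_single lookup_minus lookup_one lookup_single
        split: if_splits)
qed

lemma g_poly_dvd:
  assumes endo: "algebra_endo \<sigma>" and t: "\<sigma> (tpow 1) = lscale q (tpow s)" and q: "q \<noteq> 0"
  shows "g_poly q s dvd r - \<sigma> r"
proof -
  interpret \<sigma>: Vector_Spaces.linear lscale lscale \<sigma>
    using endo by (simp add: algebra_endo_def)
  have one: "\<sigma> 1 = 1" and mult: "\<sigma> (a * b) = \<sigma> a * \<sigma> b" for a b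
    using endo by (auto simp: algebra_endo_def)
  let ?g = "g_poly q s"
  let ?P = "\<lambda>a. ?g dvd a - \<sigma> a"
  have P_mult: "?P (a * b)" if "?P a" "?P b" for a b
  proof -
    have "a * b - \<sigma> (a * b) = a * (b - \<sigma> b) + (a - \<sigma> a) * \<sigma> b"
      by (simp add: mult algebra_simps)
    then show ?thesis using that by simp
  qed
  have P_const: "?P (Poly_Mapping.single 0 c)" for c
  proof -
    have "\<sigma> (lscale c 1) = lscale c 1" by (simp add: \<sigma>.scale one)
    then show ?thesis by (simp add: lscale_def)
  qed
  have P_t: "?P (tpow 1)"
  proof (cases "s \<ge> 1")
    case True
    then have "tpow 1 - \<sigma> (tpow 1) = ?g * tpow 1"
      by (simp add: t g_poly_def lscale_def mult_single algebra_simps)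
    then show ?thesis by simp
  next
    case False
    then have "tpow 1 - \<sigma> (tpow 1) = ?g * (- Poly_Mapping.single s q)"
      using q by (simp add: t g_poly_def lscale_def mult_single algebra_simps)
    then show ?thesis by (metis dvd_triv_left)
  qed
  have inv: "tpow 1 * tpow (-1) = 1" by (simp add: mult_single)
  then have inv': "\<sigma> (tpow 1) * \<sigma> (tpow (-1)) = 1" by (metis one mult)
  have P_ti: "?P (tpow (-1))"
  proof -
    have "tpow (-1) - \<sigma> (tpow (-1))
        = tpow (-1) * (\<sigma> (tpow 1) * \<sigma> (tpow (-1))) - \<sigma> (tpow (-1)) * (tpow 1 * tpow (-1))"
      by (simp only: inv inv' mult_1_right)
    also have "\<dots> = (tpow 1 - \<sigma> (tpow 1)) * (- (tpow (-1) * \<sigma> (tpow (-1))))"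
      by (simp add: algebra_simps del: mult_single)
    finally show ?thesis using P_t by simp
  qed
  have P_nat: "?P (tpow (int n))" "?P (tpow (- int n))" for n
  proof (induction n)
    case 0
    { case 1 show ?case using P_const[of 1] by simp }
    { case 2 show ?case using P_const[of 1] by simp }
  next
    case (Suc n)
    { case 1 show ?case using P_mult[OF P_t Suc(1)] by (simp add: mult_single) }
    { case 2 show ?case using P_mult[OF P_ti Suc(2)] by (simp add: mult_single algebra_simps) }
  qed
  have P_tpow: "?P (tpow k)" for k
    by (cases k rule: int_cases2) (use P_nat in auto)
  have P_single: "?P (Poly_Mapping.single k c)" for k c
    using P_mult[OF P_const[of c] P_tpow[of k]] by (simp add: mult_single)
  show ?thesis
  proof (induction r rule: update_induct)
    case const
    show ?case by (simp add: \<sigma>.zero)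
  next
    case (update a k c)
    let ?m = "Poly_Mapping.single k c"
    have "Poly_Mapping.update k c a = a + ?m"
      by (rule poly_mapping_eqI)
        (use update in \<open>auto simp: lookup_update lookup_add lookup_single in_keys_iff when_def\<close>)
    moreover have "a + ?m - \<sigma> (a + ?m) = (a - \<sigma> a) + (?m - \<sigma> ?m)" by (simp add: \<sigma>.add)
    ultimately show ?case using dvd_add[OF update(3) P_single[of k c]] by (simp only:)
  qed
qed

lemma Delta_unique:
  assumes "s \<noteq> 1" and "g_poly q s * b = r - \<sigma> r"
  shows "Delta q s \<sigma> r = b"
  unfolding Delta_def
  using assms(2) g_poly_nonzero[OF assms(1)] by (intro the_equality) (simp, metis mult_left_cancel)

lemma Delta_eq:
  assumes "algebra_endo \<sigma>" and "\<sigma> (tpow 1) = lscale q (tpow s)" and "q \<noteq> 0" and "s \<noteq> 1"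
  shows "g_poly q s * Delta q s \<sigma> r = r - \<sigma> r"
  using g_poly_dvd[OF assms(1-3), of r] Delta_unique[OF assms(4)] by (metis dvdE)

end

theory Submission
  imports Defs
begin

text \<open>
  Multiplying \<open>\<Delta>\<close> by Laurent polynomials identifies \<open>\<A>\<close> with the module of \<open>\<sigma>\<close>-derivations.
  Indeed, comparing \<open>D (ab)\<close> with \<open>D (ba)\<close> gives \<open>(a - \<sigma> a) D b = (b - \<sigma> b) D a\<close>, and after
  cancelling \<open>g\<close> this reads \<open>\<Delta> a D b = \<Delta> b D a\<close>. Since \<open>\<Delta> t\<close> is a monomial, hence a unit, every
  \<open>D\<close> is determined by its value at \<open>t\<close> and is a multiple of \<open>\<Delta>\<close> (\<open>sigma_derivations_eq\<close>).
  Because \<open>id - \<sigma> = g \<Delta>\<close>, the inner derivations correspond to the ideal \<open>g \<A>\<close>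
  (\<open>inner_derivations_eq\<close>).

  What remains is a division statement: \<open>1, t, \<dots>, t^(d-1)\<close> represent a basis of \<open>\<A> / g \<A>\<close>, where
  \<open>g = 1 - \<lambda> t^d\<close> with \<open>\<lambda> \<noteq> 0\<close>. They span, since \<open>t^k\<close> and \<open>t^(k+d)\<close> are proportional modulo \<open>g\<close>
  (\<open>remainders_span\<close>). They are independent, since a nonzero multiple of \<open>g\<close> has exponents that
  differ by at least \<open>d\<close> (\<open>remainders_independent\<close>).
\<close>

section \<open>Direct sums of lines and one further subspace\<close>

text \<open>
  A member of the line through \<open>e n\<close> is recorded by a coefficient \<open>c n\<close>. Two decompositions of the
  same vector differ by a combination of the \<open>e n\<close> that lies in \<open>I\<close>, so independence modulo \<open>I\<close>
  yields uniqueness.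
\<close>

lemma (in vector_space) internal_direct_sum_lines_subspace:
  assumes V: "subspace V" and I: "subspace I" "I \<subseteq> V" and e: "\<And>n. n < d \<Longrightarrow> e n \<in> V"
    and spanning: "\<And>v. v \<in> V \<Longrightarrow> \<exists>c. \<exists>w\<in>I. v = (\<Sum>n<d. scale (c n) (e n)) + w"
    and independent: "\<And>c. (\<Sum>n<d. scale (c n) (e n)) \<in> I \<Longrightarrow> \<forall>n<d. c n = 0"
  shows "internal_direct_sum scale V (map (\<lambda>n. span {e n}) [0..<d] @ [I])"
proof -
  let ?Ws = "map (\<lambda>n. span {e n}) [0..<d] @ [I]"
  let ?L = "\<lambda>c w. map (\<lambda>n. scale (c n) (e n)) [0..<d] @ [w]"
  have sum_L: "sum_list (?L c w) = (\<Sum>n<d. scale (c n) (e n)) + w" for c w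
    by (simp add: interv_sum_list_conv_sum_set_nat atLeast0LessThan)
  have mem_L: "list_all2 (\<in>) (?L c w) ?Ws" if "w \<in> I" for c w
    using that by (intro list_all2_appendI) (auto simp: list_all2_conv_all_nth span_base span_scale)
  have obtain_L: "\<exists>c. \<exists>w\<in>I. ws = ?L c w" if ws: "list_all2 (\<in>) ws ?Ws" for ws
  proof -
    obtain us w where us: "ws = us @ [w]" "list_all2 (\<in>) us (map (\<lambda>n. span {e n}) [0..<d])" "w \<in> I"
      using ws by (auto simp: list_all2_append2 list_all2_Cons2)
    from us(2) have len: "length us = d" and "\<forall>n<d. us ! n \<in> span {e n}"
      by (auto simp: list_all2_conv_all_nth)
    then have "\<forall>n<d. \<exists>k. us ! n = scale k (e n)" by (auto simp: span_singleton)
    then obtain c where "\<forall>n<d. us ! n = scale (c n) (e n)" by metis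
    with len have "us = map (\<lambda>n. scale (c n) (e n)) [0..<d]" by (auto intro: nth_equalityI)
    with us show ?thesis by auto
  qed
  have "\<exists>!ws. list_all2 (\<in>) ws ?Ws \<and> v = sum_list ws" if v: "v \<in> V" for v
  proof -
    obtain c w where w: "w \<in> I" and vcw: "v = (\<Sum>n<d. scale (c n) (e n)) + w"
      using spanning[OF v] by blast
    show ?thesis
    proof (rule ex1I)
      show "list_all2 (\<in>) (?L c w) ?Ws \<and> v = sum_list (?L c w)"
        using mem_L[OF w] vcw sum_L by simp
    next
      fix ws assume ws: "list_all2 (\<in>) ws ?Ws \<and> v = sum_list ws"
      then obtain c' w' where w': "w' \<in> I" and eq: "ws = ?L c' w'" using obtain_L by blast
      with ws have "v = (\<Sum>n<d. scale (c' n) (e n)) + w'" using sum_L by simp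
      then have "(\<Sum>n<d. scale (c n - c' n) (e n)) = w' - w"
        using vcw by (simp add: scale_left_diff_distrib sum_subtractf algebra_simps)
      then have "\<forall>n<d. c n = c' n"
        using independent[of "\<lambda>n. c n - c' n"] subspace_diff[OF I(1) w' w] by simp
      moreover from this have "w' = w"
        using vcw \<open>v = (\<Sum>n<d. scale (c' n) (e n)) + w'\<close> by simp
      ultimately show "ws = ?L c w" using eq by simp
    qed
  qed
  moreover have "\<forall>W\<in>set ?Ws. subspace W \<and> W \<subseteq> V"
    using I V span_minimal[OF _ V] e by auto
  ultimately show ?thesis using V unfolding internal_direct_sum_def by blast
qed

section \<open>Laurent polynomials modulo a binomial\<close>

lemma update_eq_add_single:
  fixes a :: laurent
  assumes "k \<notin> Poly_Mapping.keys a"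
  shows "Poly_Mapping.update k c a = a + Poly_Mapping.single k c"
  by (rule poly_mapping_eqI)
    (use assms in \<open>auto simp: lookup_update lookup_add lookup_single in_keys_iff when_def\<close>)

lemma laurent_subspace_containing_tpow:
  assumes W: "laurent.subspace W" and t: "\<And>k. tpow k \<in> W"
  shows "a \<in> W"
proof (induction a rule: update_induct)
  case const
  show ?case by (rule laurent.subspace_0[OF W])
next
  case (update a k c)
  have "Poly_Mapping.update k c a = a + lscale c (tpow k)"
    using update by (simp add: update_eq_add_single lscale_def mult_single)
  then show ?case
    using update(3) t W by (simp add: laurent.subspace_add laurent.subspace_scale)
qed

lemma lookup_single_mult:
  fixes a :: laurent
  shows "Poly_Mapping.lookup (Poly_Mapping.single k c * a) n = c * Poly_Mapping.lookup a (n - k)"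
proof (induction a rule: update_induct)
  case const
  show ?case by simp
next
  case (update a l b)
  show ?case
    using update(3) update_eq_add_single[OF update(1)]
    by (auto simp: distrib_left mult_single lookup_add lookup_single when_def)
qed

lemma lookup_lscale: "Poly_Mapping.lookup (lscale c a) n = c * Poly_Mapping.lookup a n"
  by (simp add: lscale_def lookup_single_mult)

lemma lscale_mult_left: "lscale c a * b = lscale c (a * b)"
  by (simp add: lscale_def mult.assoc)

lemma lscale_mult_right: "a * lscale c b = lscale c (a * b)"
  by (simp add: lscale_def ac_simps)

text \<open>
  The sign of \<open>s - 1\<close> matters only for the value of \<open>l\<close>, so the division theory is developed for
  this common form of the two cases of \<open>g\<close>.
\<close>

definition laurent_binomial :: "complex \<Rightarrow> nat \<Rightarrow> laurent" where
  "laurent_binomial l d = 1 - lscale l (tpow (int d))"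

lemma binomial_mult: "laurent_binomial l d * a = a - lscale l (tpow (int d) * a)"
  by (simp add: laurent_binomial_def left_diff_distrib lscale_mult_left)

lemma lookup_binomial_mult:
  "Poly_Mapping.lookup (laurent_binomial l d * a) n =
     Poly_Mapping.lookup a n - l * Poly_Mapping.lookup a (n - int d)"
  by (simp add: binomial_mult lookup_minus lookup_lscale lookup_single_mult)

lemma lookup_tpow_combination:
  "Poly_Mapping.lookup (\<Sum>n<d. lscale (c n) (tpow (int n))) k =
     (if 0 \<le> k \<and> k < int d then c (nat k) else 0)"
proof -
  have "Poly_Mapping.lookup (\<Sum>n<d. lscale (c n) (tpow (int n))) k
      = (\<Sum>n<d. if n = nat k then (if 0 \<le> k then c n else 0) else 0)"
    unfolding lookup_sum by (rule sum.cong) (auto simp: lookup_lscale lookup_single when_def)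
  then show ?thesis by (auto simp: nat_less_iff)
qed

text \<open>
  Modulo the binomial \<open>g = 1 - l t^d\<close>, multiplication by \<open>t^d\<close> is multiplication by the nonzero
  scalar \<open>1 / l\<close>, so every exponent can be moved up or down by \<open>d\<close> until it lies in \<open>[0, d)\<close>.
\<close>

lemma remainders_span:
  assumes l: "l \<noteq> 0" and d: "d > 0"
  shows "\<exists>c p. a = (\<Sum>n<d. lscale (c n) (tpow (int n))) + laurent_binomial l d * p"
proof -
  let ?g = "laurent_binomial l d"
  let ?R = "\<lambda>c. \<Sum>n<d. lscale (c n) (tpow (int n))"
  define W where "W = {a. \<exists>c p. a = ?R c + ?g * p}"
  have W_I: "a \<in> W" if "a = ?R c + ?g * p" for a c p
    unfolding W_def using that by (intro CollectI exI)
  have W: "laurent.subspace W"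
  proof (rule laurent.subspaceI)
    show "0 \<in> W" by (rule W_I[of _ "\<lambda>_. 0" 0]) simp
  next
    fix a b assume "a \<in> W" "b \<in> W"
    then obtain c p c' p' where "a = ?R c + ?g * p" "b = ?R c' + ?g * p'"
      unfolding W_def by blast
    then show "a + b \<in> W"
      by (intro W_I[of _ "\<lambda>n. c n + c' n" "p + p'"])
        (simp add: laurent.scale_left_distrib sum.distrib distrib_left)
  next
    fix k a assume "a \<in> W"
    then obtain c p where "a = ?R c + ?g * p"
      unfolding W_def by blast
    then show "lscale k a \<in> W"
      by (intro W_I[of _ "\<lambda>n. k * c n" "lscale k p"])
        (simp add: laurent.scale_right_distrib laurent.scale_sum_right lscale_mult_right)
  qed
  have gW: "?g * p \<in> W" for p
    by (rule W_I[of _ "\<lambda>_. 0" p]) simp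
  have low: "tpow (int i) \<in> W" if "i < d" for i
    using that
    by (intro W_I[of _ "\<lambda>n. if n = i then 1 else 0" 0])
      (simp add: if_distrib[of "\<lambda>x. lscale x _"] cong: if_cong)
  have g_tpow: "?g * tpow k = tpow k - lscale l (tpow (k + int d))" for k
    by (simp add: binomial_mult mult_single add.commute)
  have up: "tpow (k + int d) \<in> W" if "tpow k \<in> W" for k
  proof -
    have "tpow (k + int d) = lscale (inverse l) (tpow k - ?g * tpow k)"
      using l by (simp add: g_tpow)
    also have "\<dots> \<in> W"
      by (intro laurent.subspace_scale laurent.subspace_diff W gW that)
    finally show ?thesis .
  qed
  have down: "tpow k \<in> W" if "tpow (k + int d) \<in> W" for k
  proof -
    have "tpow k = ?g * tpow k + lscale l (tpow (k + int d))" by (simp add: g_tpow)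
    also have "\<dots> \<in> W"
      by (intro laurent.subspace_scale laurent.subspace_add W gW that)
    finally show ?thesis .
  qed
  have shift: "tpow (i + j * int d) \<in> W" if "tpow i \<in> W" for i j
  proof (induction j rule: int_induct[where k = 0])
    case base
    show ?case using that by simp
  next
    case (step1 j)
    then show ?case using up[of "i + j * int d"] by (simp add: algebra_simps)
  next
    case (step2 j)
    then show ?case using down[of "i + (j - 1) * int d"] by (simp add: algebra_simps)
  qed
  have "tpow k \<in> W" for k
  proof -
    have "tpow (int (nat (k mod int d))) \<in> W"
      using d by (intro low) (simp add: nat_less_iff)
    then show ?thesis using shift[of "k mod int d" "k div int d"] d by simp
  qed
  then have "a \<in> W" by (rule laurent_subspace_containing_tpow[OF W])
  then show ?thesis unfolding W_def by blast
qed

text \<open>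
  If \<open>p \<noteq> 0\<close> has lowest exponent \<open>m\<close> and highest exponent \<open>M\<close>, then the binomial times \<open>p\<close> has
  nonzero coefficients at \<open>m\<close> and at \<open>M + d\<close>, as nothing cancels at the two ends. Both would
  have to lie in \<open>[0, d)\<close>, which forces \<open>M < 0 \<le> m\<close>.
\<close>

lemma remainders_independent:
  assumes l: "l \<noteq> 0" and d: "d > 0"
    and eq: "(\<Sum>n<d. lscale (c n) (tpow (int n))) = laurent_binomial l d * p"
  shows "\<forall>n<d. c n = 0"
proof -
  let ?K = "Poly_Mapping.keys p"
  have rec: "Poly_Mapping.lookup p k - l * Poly_Mapping.lookup p (k - int d) =
      (if 0 \<le> k \<and> k < int d then c (nat k) else 0)" for k
    using lookup_tpow_combination[of c d k] lookup_binomial_mult[of l d p k] eq by simp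
  have "p = 0"
  proof (rule ccontr)
    assume "p \<noteq> 0"
    then have K: "finite ?K" "?K \<noteq> {}" by auto
    have "Min ?K \<in> ?K" "Min ?K - int d \<notin> ?K"
      using K d Min_in[of ?K] Min_le[of ?K "Min ?K - int d"] by linarith+
    then have "0 \<le> Min ?K"
      using rec[of "Min ?K"] by (auto simp: in_keys_iff split: if_splits)
    moreover have "Max ?K \<in> ?K" "Max ?K + int d \<notin> ?K"
      using K d Max_in[of ?K] Max_ge[of ?K "Max ?K + int d"] by linarith+
    then have "Max ?K < 0"
      using rec[of "Max ?K + int d"] l by (auto simp: in_keys_iff split: if_splits)
    moreover have "Min ?K \<le> Max ?K" using K by simp
    ultimately show False by simp
  qed
  show ?thesis
  proof (intro allI impI)
    fix n assume "n < d"
    then show "c n = 0" using rec[of "int n"] \<open>p = 0\<close> by simp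
  qed
qed

section \<open>The module of twisted derivations\<close>

lemma g_poly_binomial:
  "g_poly q s = laurent_binomial (if s \<ge> 1 then q else inverse q) (nat \<bar>s - 1\<bar>)"
  by (auto simp: g_poly_def laurent_binomial_def)

text \<open>
  Each identity holds for \<open>id - \<sigma>\<close> in place of \<open>\<Delta>\<close>, and passes to \<open>\<Delta>\<close> because
  \<open>id - \<sigma> = g \<Delta>\<close> and division by \<open>g\<close> is unique.
\<close>

lemma Delta_sigma_derivation:
  assumes "algebra_endo \<sigma>" and "\<sigma> (tpow 1) = lscale q (tpow s)" and "q \<noteq> 0" and "s \<noteq> 1"
  shows "Delta q s \<sigma> (a + b) = Delta q s \<sigma> a + Delta q s \<sigma> b"
    and "Delta q s \<sigma> (lscale k a) = lscale k (Delta q s \<sigma> a)"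
    and "Delta q s \<sigma> (a * b) = \<sigma> a * Delta q s \<sigma> b + Delta q s \<sigma> a * b"
proof -
  let ?g = "g_poly q s" and ?\<Delta> = "Delta q s \<sigma>"
  interpret \<sigma>: Vector_Spaces.linear lscale lscale \<sigma>
    using assms(1) by (simp add: algebra_endo_def)
  have mult: "\<sigma> (a * b) = \<sigma> a * \<sigma> b" for a b
    using assms(1) by (auto simp: algebra_endo_def)
  note D = Delta_eq[OF assms]
  show "?\<Delta> (a + b) = ?\<Delta> a + ?\<Delta> b"
    by (rule Delta_unique[OF assms(4)]) (simp add: distrib_left D \<sigma>.add)
  show "?\<Delta> (lscale k a) = lscale k (?\<Delta> a)"
    by (rule Delta_unique[OF assms(4)])
      (simp add: lscale_mult_right D \<sigma>.scale laurent.scale_right_diff_distrib)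
  have "?g * (\<sigma> a * ?\<Delta> b + ?\<Delta> a * b) = \<sigma> a * (?g * ?\<Delta> b) + (?g * ?\<Delta> a) * b"
    by (simp add: algebra_simps)
  also have "\<dots> = a * b - \<sigma> (a * b)" by (simp add: D mult algebra_simps)
  finally show "?\<Delta> (a * b) = \<sigma> a * ?\<Delta> b + ?\<Delta> a * b" by (rule Delta_unique[OF assms(4)])
qed

text \<open>
  By the choice of \<open>g\<close>, the value \<open>\<Delta> t\<close> is \<open>t\<close> if \<open>s \<ge> 1\<close>, and \<open>- q t^s\<close> otherwise.
\<close>

lemma Delta_tpow_1_unit:
  assumes "\<sigma> (tpow 1) = lscale q (tpow s)" and "q \<noteq> 0" and "s \<noteq> 1"
  shows "Delta q s \<sigma> (tpow 1) dvd 1"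
proof (cases "s \<ge> 1")
  case True
  then have "Delta q s \<sigma> (tpow 1) = tpow 1"
    by (intro Delta_unique[OF assms(3)])
      (simp add: assms(1) g_poly_def lscale_def mult_single algebra_simps)
  moreover have "tpow 1 * tpow (-1) = 1" by (simp add: mult_single)
  ultimately show ?thesis by (metis dvd_triv_left)
next
  case False
  then have "Delta q s \<sigma> (tpow 1) = Poly_Mapping.single s (- q)"
    using assms(2)
    by (intro Delta_unique[OF assms(3)])
      (simp add: assms(1) g_poly_def lscale_def mult_single algebra_simps single_uminus)
  moreover have "Poly_Mapping.single s (- q) * Poly_Mapping.single (- s) (- inverse q) = 1"
    using assms(2) by (simp add: mult_single)
  ultimately show ?thesis by (metis dvd_triv_left)
qed

text \<open>
  Commutativity of the algebra makes any two \<open>\<sigma>\<close>-derivations proportional; as \<open>\<Delta> t\<close> is a unit,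
  the factor relating \<open>D\<close> to \<open>\<Delta>\<close> is \<open>D t / \<Delta> t\<close>.
\<close>

lemma sigma_derivations_eq:
  assumes "algebra_endo \<sigma>" and "\<sigma> (tpow 1) = lscale q (tpow s)" and "q \<noteq> 0" and "s \<noteq> 1"
  shows "sigma_derivations \<sigma> = range (\<lambda>a r. a * Delta q s \<sigma> r)"
proof (intro equalityI subsetI)
  let ?g = "g_poly q s" and ?\<Delta> = "Delta q s \<sigma>"
  fix D assume "D \<in> sigma_derivations \<sigma>"
  then have D: "D (a * b) = \<sigma> a * D b + D a * b" for a b
    by (auto simp: sigma_derivations_def)
  obtain u where u: "1 = ?\<Delta> (tpow 1) * u"
    using Delta_tpow_1_unit[of \<sigma> q s] assms by blast
  have "D r = (D (tpow 1) * u) * ?\<Delta> r" for r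
  proof -
    \<comment> \<open>Expand \<open>D\<close> on the two equal products \<open>r t\<close> and \<open>t r\<close>.\<close>
    have "(r - \<sigma> r) * D (tpow 1) = (tpow 1 - \<sigma> (tpow 1)) * D r"
      using D[of r "tpow 1"] D[of "tpow 1" r] by (simp add: algebra_simps)
    then have "?g * (?\<Delta> r * D (tpow 1)) = ?g * (?\<Delta> (tpow 1) * D r)"
      by (simp add: Delta_eq[OF assms, symmetric] mult.assoc)
    then have "?\<Delta> r * D (tpow 1) = ?\<Delta> (tpow 1) * D r"
      using g_poly_nonzero[OF assms(4)] by (metis mult_left_cancel)
    then have "?\<Delta> r * D (tpow 1) * u = ?\<Delta> (tpow 1) * D r * u" by (rule arg_cong)
    also have "\<dots> = (?\<Delta> (tpow 1) * u) * D r" by (simp only: ac_simps)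
    also have "\<dots> = D r" by (simp only: u[symmetric] mult_1_left)
    finally show ?thesis by (simp only: ac_simps)
  qed
  then show "D \<in> range (\<lambda>a r. a * ?\<Delta> r)" by blast
next
  fix D assume "D \<in> range (\<lambda>a r. a * Delta q s \<sigma> r)"
  then obtain a where "D = (\<lambda>r. a * Delta q s \<sigma> r)" by blast
  then show "D \<in> sigma_derivations \<sigma>"
    unfolding sigma_derivations_def
    by (auto intro!: Vector_Spaces.linear.intro module_hom.intro module_hom_axioms.intro
         laurent.module_axioms laurent.vector_space_axioms
         simp: Delta_sigma_derivation[OF assms] algebra_simps lscale_mult_right)
qed

lemma inner_derivations_eq:
  assumes "algebra_endo \<sigma>" and "\<sigma> (tpow 1) = lscale q (tpow s)" and "q \<noteq> 0" and "s \<noteq> 1"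
  shows "inner_derivations \<sigma> = range (\<lambda>p r. (g_poly q s * p) * Delta q s \<sigma> r)"
proof -
  have "(\<lambda>r. p * (r - \<sigma> r)) = (\<lambda>r. (g_poly q s * p) * Delta q s \<sigma> r)" for p
    by (simp add: Delta_eq[OF assms, symmetric] ac_simps)
  then show ?thesis
    unfolding inner_derivations_def sigma_derivations_eq[OF assms] by auto
qed

theorem theorem4p2p1:
  fixes \<sigma> :: "laurent \<Rightarrow> laurent" and q :: complex and s :: int and d :: nat
  assumes "algebra_endo \<sigma>"
    and "\<sigma> (tpow 1) = lscale q (tpow s)"
    and "q \<noteq> 0"
    and "s \<noteq> 1"
    and "d = nat \<bar>s - 1\<bar>"
  shows "internal_direct_sum mscale (sigma_derivations \<sigma>)
           (map (\<lambda>n. module.span mscale {dmap q s \<sigma> (int n)}) [0..<d] @ [inner_derivations \<sigma>])"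
proof (rule lmap.internal_direct_sum_lines_subspace)
  let ?g = "g_poly q s" and ?M = "\<lambda>a r. a * Delta q s \<sigma> r"
  let ?l = "if s \<ge> 1 then q else inverse q"
  note Der = sigma_derivations_eq[OF assms(1-4)] and Inn = inner_derivations_eq[OF assms(1-4)]
  have g: "?g = laurent_binomial ?l d" by (simp add: g_poly_binomial assms(5))
  have l: "?l \<noteq> 0" and d: "d > 0" using assms by auto
  \<comment> \<open>All derivations are the case \<open>b = 1\<close>, the inner ones the case \<open>b = g\<close>.\<close>
  have subspace_range: "lmap.subspace (range (\<lambda>p. ?M (b * p)))" for b
  proof (rule lmap.subspaceI)
    have "(0 :: laurent \<Rightarrow> laurent) = ?M (b * 0)" by (simp add: fun_eq_iff)
    then show "0 \<in> range (\<lambda>p. ?M (b * p))" by blast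
  next
    fix D E assume "D \<in> range (\<lambda>p. ?M (b * p))" "E \<in> range (\<lambda>p. ?M (b * p))"
    then obtain p p' where "D = ?M (b * p)" "E = ?M (b * p')" by blast
    then have "D + E = ?M (b * (p + p'))" by (simp add: fun_eq_iff algebra_simps)
    then show "D + E \<in> range (\<lambda>p. ?M (b * p))" by blast
  next
    fix k D assume "D \<in> range (\<lambda>p. ?M (b * p))"
    then obtain p where "D = ?M (b * p)" by blast
    then have "mscale k D = ?M (b * lscale k p)"
      by (simp add: fun_eq_iff mscale_def lscale_mult_left lscale_mult_right)
    then show "mscale k D \<in> range (\<lambda>p. ?M (b * p))" by blast
  qed
  show "lmap.subspace (sigma_derivations \<sigma>)"
    using subspace_range[of 1] by (simp add: Der)
  show "lmap.subspace (inner_derivations \<sigma>)"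
    using subspace_range[of ?g] by (simp add: Inn)
  show "inner_derivations \<sigma> \<subseteq> sigma_derivations \<sigma>"
    by (auto simp: inner_derivations_def)
  show "dmap q s \<sigma> (int n) \<in> sigma_derivations \<sigma>" for n
    unfolding Der dmap_def by (rule rangeI)
  have sum_dmap: "(\<Sum>n<k. mscale (c n) (dmap q s \<sigma> (int n))) =
      ?M (- (\<Sum>n<k. lscale (c n) (tpow (int n))))" for c k
    by (induction k) (simp_all add: fun_eq_iff mscale_def dmap_def lscale_mult_left lscale_mult_right
      algebra_simps)
  show "\<exists>c. \<exists>w\<in>inner_derivations \<sigma>. D = (\<Sum>n<d. mscale (c n) (dmap q s \<sigma> (int n))) + w"
    if D: "D \<in> sigma_derivations \<sigma>" for D
  proof -
    obtain a where a: "D = ?M a" using D unfolding Der by (elim rangeE)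
    \<comment> \<open>Divide \<open>- a\<close> rather than \<open>a\<close>, because of the sign in \<open>d_n = - t^n \<Delta>\<close>.\<close>
    obtain c p where "- a = (\<Sum>n<d. lscale (c n) (tpow (int n))) + ?g * p"
      using remainders_span[OF l d] unfolding g by blast
    then have "a = - (\<Sum>n<d. lscale (c n) (tpow (int n))) + ?g * (- p)"
      by (metis add.inverse_inverse minus_add_distrib mult_minus_right)
    then have "D = (\<Sum>n<d. mscale (c n) (dmap q s \<sigma> (int n))) + ?M (?g * (- p))"
      by (simp add: a sum_dmap fun_eq_iff left_diff_distrib)
    moreover have "?M (?g * (- p)) \<in> inner_derivations \<sigma>" unfolding Inn by blast
    ultimately show ?thesis by blast
  qed
  show "\<forall>n<d. c n = 0"
    if inner: "(\<Sum>n<d. mscale (c n) (dmap q s \<sigma> (int n))) \<in> inner_derivations \<sigma>" for c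
  proof -
    obtain p where p: "?M (- (\<Sum>n<d. lscale (c n) (tpow (int n)))) = ?M (?g * p)"
      using inner unfolding sum_dmap Inn by (elim rangeE)
    \<comment> \<open>Evaluation at \<open>t\<close> recovers the coefficient \<open>a\<close> of \<open>a \<Delta>\<close>.\<close>
    have "Delta q s \<sigma> (tpow 1) \<noteq> 0"
      using Delta_tpow_1_unit[of \<sigma> q s] assms by auto
    then have neg: "- (\<Sum>n<d. lscale (c n) (tpow (int n))) = ?g * p"
      using fun_cong[OF p, of "tpow 1"] by (rule mult_right_cancel[THEN iffD1])
    have "(\<Sum>n<d. lscale (c n) (tpow (int n))) = laurent_binomial ?l d * (- p)"
      using arg_cong[OF neg, of uminus] by (simp only: g add.inverse_inverse mult_minus_right)
    then show ?thesis by (rule remainders_independent[OF l d])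
  qed
qed

end
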